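(* Let $N\ge1$ be an integer and $k=(k_1,\dots,k_N)\in\mathbb R_{>0}^N$. The operator $L^{\mathrm{BEP}}$ is self-dual, with duality function $$D(x,y)=\prod_{j=1}^N J(x_j,y_j;k_j),\qquad x,y\in\mathbb R_{>0}^N,$$ i.e. $[L^{\mathrm{BEP}}D(\cdot,y)](x)=[L^{\mathrm{BEP}}D(x,\cdot)](y)$ for all $x,y\in\mathbb R_{>0}^N$.
   Context: $L^{\mathrm{BEP}}$ is the generator of the Brownian energy process BEP($k$): for smooth functions $f$ on $\mathbb R_{>0}^N$, $$L^{\mathrm{BEP}}f(x)=\sum_{1\le i<j\le N}\left[x_ix_j\left(\frac{\partial}{\partial x_i}-\frac{\partial}{\partial x_j}\right)^2f(x)-2(k_jx_i-k_ix_j)\left(\frac{\partial}{\partial x_i}-\frac{\partial}{\partial x_j}\right)f(x)\right].$$ $J_\nu(x)=\sum_{m=0}^\infty\frac{(-1)^m}{m!\,\Gamma(\nu+m+1)}\left(\frac x2\right)^{\nu+2m}$ is the Bessel function of the first kind, and $$J(x,y;k)=e^{\frac12(x+y)}(xy)^{-k+\frac12}J_{2k-1}(\sqrt{xy}),\qquad x,y>0.$$ *)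

theory Defs
  imports "HOL-Analysis.Analysis"
begin

text \<open>
  Points of \<open>\<real>\<^sup>N\<close> are vectors of type \<open>real ^ 'n\<close> whose index type is finite and linearly
  ordered, so that the sum over pairs \<open>i < j\<close> can be written literally; \<open>N = CARD('n)\<close>, and
  \<open>N \<ge> 1\<close> holds since types are nonempty.
\<close>

definition pos_orthant :: "(real ^ 'n) set" where
  "pos_orthant = {x. \<forall>i. x $ i > 0}"

definition partial_deriv :: "'n::finite \<Rightarrow> (real ^ 'n \<Rightarrow> real) \<Rightarrow> real ^ 'n \<Rightarrow> real" where
  "partial_deriv i f x = deriv (\<lambda>t. f (x + t *\<^sub>R axis i 1)) 0"

text \<open>
  Smoothness on a set, meant for open sets: all iterated partial derivatives exist and are
  continuous. Since \<^const>\<open>deriv\<close> is total, existence of each derivative is required explicitly.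
\<close>

definition smooth_on :: "(real ^ 'n::finite) set \<Rightarrow> (real ^ 'n \<Rightarrow> real) \<Rightarrow> bool" where
  "smooth_on S f \<longleftrightarrow>
     (\<forall>is. continuous_on S (foldr partial_deriv is f) \<and>
       (\<forall>i. \<forall>x\<in>S. (\<lambda>t. foldr partial_deriv is f (x + t *\<^sub>R axis i 1)) differentiable (at 0)))"

definition partial_diff :: "'n::finite \<Rightarrow> 'n \<Rightarrow> (real ^ 'n \<Rightarrow> real) \<Rightarrow> real ^ 'n \<Rightarrow> real" where
  "partial_diff i j f x = partial_deriv i f x - partial_deriv j f x"

definition L_BEP ::
  "real ^ 'n::{finite,linorder} \<Rightarrow> (real ^ 'n::{finite,linorder} \<Rightarrow> real) \<Rightarrow> real ^ 'n::{finite,linorder} \<Rightarrow> real" where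
  "L_BEP k f x =
     (\<Sum>(i, j) \<in> {(i, j). i < j}.
        x $ i * x $ j * partial_diff i j (partial_diff i j f) x
        - 2 * (k $ j * x $ i - k $ i * x $ j) * partial_diff i j f x)"

text \<open>
  The operator acts on smooth functions on the positive orthant, so self-duality includes the
  requirement that the duality function is smooth in each of its two arguments.
\<close>

definition self_dual ::
  "((real ^ 'n::finite \<Rightarrow> real) \<Rightarrow> real ^ 'n \<Rightarrow> real) \<Rightarrow> (real ^ 'n \<Rightarrow> real ^ 'n \<Rightarrow> real) \<Rightarrow> bool"
where
  "self_dual L D \<longleftrightarrow>
     (\<forall>y\<in>pos_orthant. smooth_on pos_orthant (\<lambda>x. D x y)) \<and>
     (\<forall>x\<in>pos_orthant. smooth_on pos_orthant (\<lambda>y. D x y)) \<and>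
     (\<forall>x\<in>pos_orthant. \<forall>y\<in>pos_orthant. L (\<lambda>x'. D x' y) x = L (\<lambda>y'. D x y') y)"

text \<open>
  The Bessel function of the first kind for a positive argument. At nonpositive integers
  \<^term>\<open>Gamma\<close> is \<open>0\<close>, and division by \<open>0\<close> gives \<open>0\<close>, which is the usual value of \<open>1 / \<Gamma>\<close> there.
\<close>

definition bessel_J :: "real \<Rightarrow> real \<Rightarrow> real" where
  "bessel_J \<nu> x =
     (\<Sum>m. (-1) ^ m / (fact m * Gamma (\<nu> + real m + 1)) * (x / 2) powr (\<nu> + 2 * real m))"

definition J_kernel :: "real \<Rightarrow> real \<Rightarrow> real \<Rightarrow> real" where
  "J_kernel x y k =
     exp ((x + y) / 2) * (x * y) powr (- k + 1 / 2) * bessel_J (2 * k - 1) (sqrt (x * y))"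

end

theory Submission
  imports Defs
begin

text \<open>
  On the positive orthant the kernel is \<open>e\<^bsup>(x+y)/2\<^esup> g(x y)\<close> with an entire function \<open>g\<close> that
  solves \<open>z g'' + 2 k g' + g / 4 = 0\<close>. In the term of the generator for the pair \<open>i < j\<close>,
  the derivation \<open>\<partial>\<^sub>i - \<partial>\<^sub>j\<close> annihilates \<open>e\<^bsup>(x\<^sub>i+x\<^sub>j)/2\<^esup>\<close>; eliminating \<open>g''\<close> by the differential
  equation leaves an expression that is symmetric under exchange of \<open>x\<close> and \<open>y\<close>. As the kernel
  itself is symmetric, this is self-duality.
\<close>

section \<open>Partial derivatives of product functions\<close>

lemma eventually_pos_orthant_line:
  fixes x :: "real ^ 'n::finite"
  assumes "x \<in> pos_orthant"
  shows "eventually (\<lambda>t. x + t *\<^sub>R axis i 1 \<in> pos_orthant) (nhds 0)"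
proof -
  have "((\<lambda>t. x $ i + t) \<longlongrightarrow> x $ i + 0) (nhds 0)"
    by (intro tendsto_intros filterlim_ident)
  then have "eventually (\<lambda>t. x $ i + t > 0) (nhds 0)"
    using assms by (auto dest!: order_tendstoD(1) simp: pos_orthant_def)
  then show ?thesis
    by eventually_elim (use assms in \<open>auto simp: pos_orthant_def axis_def\<close>)
qed

text \<open>The product formula is known only on the orthant. That set is open, so the formula
  persists for small \<open>t\<close>, where only factor \<open>i\<close> varies; this suffices for
  the derivative at 0.\<close>

lemma DERIV_prod_line:
  fixes h :: "'n::finite \<Rightarrow> real \<Rightarrow> real"
  assumes f: "\<And>z. z \<in> pos_orthant \<Longrightarrow> f z = (\<Prod>l\<in>UNIV. h l (z $ l))"
    and x: "x \<in> pos_orthant"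
    and d: "(h i has_field_derivative d (x $ i)) (at (x $ i))"
  shows "((\<lambda>t. f (x + t *\<^sub>R axis i 1)) has_field_derivative
           (\<Prod>l\<in>UNIV. (h(i := d)) l (x $ l))) (at 0)"
proof -
  let ?R = "\<Prod>l\<in>UNIV - {i}. h l (x $ l)"
  have ev: "eventually (\<lambda>t. f (x + t *\<^sub>R axis i 1) = h i (x $ i + t) * ?R) (nhds 0)"
    using eventually_pos_orthant_line[OF x, of i]
  proof eventually_elim
    case (elim t)
    then have "f (x + t *\<^sub>R axis i 1) = (\<Prod>l\<in>UNIV. h l ((x + t *\<^sub>R axis i 1) $ l))"
      by (rule f)
    also have "\<dots> = h i (x $ i + t) * (\<Prod>l\<in>UNIV - {i}. h l ((x + t *\<^sub>R axis i 1) $ l))"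
      by (subst prod.remove[of _ i]) (auto simp: axis_def)
    also have "(\<Prod>l\<in>UNIV - {i}. h l ((x + t *\<^sub>R axis i 1) $ l)) = ?R"
      by (rule prod.cong) (auto simp: axis_def)
    finally show ?case .
  qed
  have "((\<lambda>t. h i (x $ i + t) * ?R) has_field_derivative d (x $ i) * ?R) (at 0)"
    using d DERIV_shift[of "h i" "d (x $ i)" 0 "x $ i"]
    by (intro DERIV_cmult_right) (simp add: add.commute)
  moreover have "(\<Prod>l\<in>UNIV. (h(i := d)) l (x $ l)) = d (x $ i) * ?R"
    by (subst prod.remove[of _ i]) (auto intro!: prod.cong)
  ultimately show ?thesis
    using DERIV_cong_ev[OF refl ev refl] by simp
qed

lemma partial_deriv_prod:
  fixes h :: "'n::finite \<Rightarrow> real \<Rightarrow> real"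
  assumes "\<And>z. z \<in> pos_orthant \<Longrightarrow> f z = (\<Prod>l\<in>UNIV. h l (z $ l))"
    and "x \<in> pos_orthant"
    and "(h i has_field_derivative d (x $ i)) (at (x $ i))"
  shows "partial_deriv i f x = (\<Prod>l\<in>UNIV. (h(i := d)) l (x $ l))"
  unfolding partial_deriv_def
  using DERIV_prod_line[where f = f and h = h and d = d, OF assms]
  by (rule DERIV_imp_deriv)

text \<open>Here \<open>h l n\<close> plays the role of the \<open>n\<close>-th derivative of factor
  \<open>l\<close>. Each partial derivative raises the order of one factor only, so an iterated one
  is again a product, with orders counted by \<open>count_list\<close>.\<close>

lemma smooth_on_prod:
  fixes h :: "'n::finite \<Rightarrow> nat \<Rightarrow> real \<Rightarrow> real"
  assumes f: "\<And>z. z \<in> pos_orthant \<Longrightarrow> f z = (\<Prod>l\<in>UNIV. h l 0 (z $ l))"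
    and h: "\<And>l n t. t > 0 \<Longrightarrow> (h l n has_field_derivative h l (Suc n) t) (at t)"
  shows "smooth_on pos_orthant f"
proof -
  have iter: "foldr partial_deriv is f z = (\<Prod>l\<in>UNIV. h l (count_list is l) (z $ l))"
    if "z \<in> pos_orthant" for "is" z
    using that
  proof (induction "is" arbitrary: z)
    case Nil
    then show ?case by (simp add: f)
  next
    case (Cons i "is")
    have "foldr partial_deriv (i # is) f z = partial_deriv i (foldr partial_deriv is f) z"
      by simp
    also have "\<dots> = (\<Prod>l\<in>UNIV.
        ((\<lambda>l. h l (count_list is l))(i := h i (Suc (count_list is i)))) l (z $ l))"
      using Cons.prems
      by (intro partial_deriv_prod[where h = "\<lambda>l. h l (count_list is l)", OF Cons.IH] h) (auto simp: pos_orthant_def)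
    also have "\<dots> = (\<Prod>l\<in>UNIV. h l (count_list (i # is) l) (z $ l))"
      by (rule prod.cong) auto
    finally show ?case .
  qed
  have cont: "continuous_on pos_orthant (foldr partial_deriv is f)" for "is"
  proof -
    have "continuous_on {0<..} (h l n)" for l n
      by (rule DERIV_continuous_on[of _ _ "h l (Suc n)"])
        (auto intro: has_field_derivative_at_within h)
    then have "continuous_on pos_orthant (\<lambda>z. \<Prod>l\<in>UNIV. h l (count_list is l) (z $ l))"
      by (intro continuous_on_prod continuous_on_compose2[where g = "h _ _" and f = "\<lambda>z. z $ _"])
        (auto intro!: continuous_intros simp: pos_orthant_def)
    then show ?thesis
      by (rule continuous_on_eq) (simp add: iter)
  qed
  have "(\<lambda>t. foldr partial_deriv is f (x + t *\<^sub>R axis i 1)) differentiable (at 0)"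
    if x: "x \<in> pos_orthant" for "is" i x
  proof -
    have "(h i (count_list is i) has_field_derivative h i (Suc (count_list is i)) (x $ i))
        (at (x $ i))"
      using x by (intro h) (simp add: pos_orthant_def)
    from DERIV_prod_line[where h = "\<lambda>l. h l (count_list is l)"
        and d = "h i (Suc (count_list is i))", OF iter x this] show ?thesis
      using real_differentiable_def by blast
  qed
  with cont show ?thesis
    unfolding smooth_on_def by blast
qed

text \<open>Splits each pair term of the generator into an expression in the two active coordinates
  and the common factor \<open>R\<close> of the undifferentiated ones.\<close>

lemma partial_diff_prod:
  fixes h :: "'n::finite \<Rightarrow> nat \<Rightarrow> real \<Rightarrow> real" and x :: "real ^ 'n"
  assumes f: "\<And>z. z \<in> pos_orthant \<Longrightarrow> f z = (\<Prod>l\<in>UNIV. h l 0 (z $ l))"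
    and h: "\<And>l n t. t > 0 \<Longrightarrow> (h l n has_field_derivative h l (Suc n) t) (at t)"
    and x: "x \<in> pos_orthant" and "i \<noteq> j"
  defines "R \<equiv> \<Prod>l\<in>UNIV - {i, j}. h l 0 (x $ l)"
  shows "partial_diff i j f x =
      (h i 1 (x $ i) * h j 0 (x $ j) - h i 0 (x $ i) * h j 1 (x $ j)) * R"
    and "partial_diff i j (partial_diff i j f) x =
      (h i 2 (x $ i) * h j 0 (x $ j) - 2 * h i 1 (x $ i) * h j 1 (x $ j)
        + h i 0 (x $ i) * h j 2 (x $ j)) * R"
proof -
  \<comment> \<open>\<open>P a b\<close> is the product with factors \<open>i\<close> and
    \<open>j\<close> differentiated \<open>a\<close> and \<open>b\<close> times; the partial
    derivatives raise these orders independently.\<close>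
  define P where "P a b z = (\<Prod>l\<in>UNIV. ((\<lambda>l. h l 0)(i := h i a, j := h j b)) l (z $ l))"
    for a b and z :: "real ^ 'n"
  have P_x: "P a b x = h i a (x $ i) * h j b (x $ j) * R" for a b
  proof -
    have "UNIV - {i, j} = UNIV - {i} - {j}" by auto
    with \<open>i \<noteq> j\<close> show ?thesis
      unfolding P_def R_def
      by (simp add: prod.remove[of UNIV i] prod.remove[of "UNIV - {i}" j])
  qed
  have P_i: "((\<lambda>t. P a b (z + t *\<^sub>R axis i 1)) has_field_derivative P (Suc a) b z) (at 0)"
    if "z \<in> pos_orthant" for a b z
    using DERIV_prod_line[where h = "(\<lambda>l. h l 0)(i := h i a, j := h j b)", OF P_def that, of i "h i (Suc a)"] that \<open>i \<noteq> j\<close>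
    unfolding P_def by (simp add: h pos_orthant_def fun_upd_twist)
  have P_j: "((\<lambda>t. P a b (z + t *\<^sub>R axis j 1)) has_field_derivative P a (Suc b) z) (at 0)"
    if "z \<in> pos_orthant" for a b z
    using DERIV_prod_line[where h = "(\<lambda>l. h l 0)(i := h i a, j := h j b)", OF P_def that, of j "h j (Suc b)"] that \<open>i \<noteq> j\<close>
    unfolding P_def by (simp add: h pos_orthant_def)
  \<comment> \<open>This is needed near \<open>x\<close>, not just at \<open>x\<close>, because the
    result is differentiated once more.\<close>
  have first: "partial_diff i j f z = P 1 0 z - P 0 1 z" if z: "z \<in> pos_orthant" for z
  proof -
    have "partial_deriv i f z = P 1 0 z"
      using partial_deriv_prod[of f "\<lambda>l. h l 0" z i "h i 1"] f z h \<open>i \<noteq> j\<close>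
      by (auto simp: P_def pos_orthant_def intro!: prod.cong)
    moreover have "partial_deriv j f z = P 0 1 z"
      using partial_deriv_prod[of f "\<lambda>l. h l 0" z j "h j 1"] f z h \<open>i \<noteq> j\<close>
      by (auto simp: P_def pos_orthant_def intro!: prod.cong)
    ultimately show ?thesis by (simp add: partial_diff_def)
  qed
  have "((\<lambda>t. partial_diff i j f (x + t *\<^sub>R axis i 1)) has_field_derivative P 2 0 x - P 1 1 x) (at 0)"
  proof (subst DERIV_cong_ev[OF refl _ refl])
    show "eventually (\<lambda>t. partial_diff i j f (x + t *\<^sub>R axis i 1)
        = P 1 0 (x + t *\<^sub>R axis i 1) - P 0 1 (x + t *\<^sub>R axis i 1)) (nhds 0)"
      using eventually_pos_orthant_line[OF x] by eventually_elim (rule first)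
    show "((\<lambda>t. P 1 0 (x + t *\<^sub>R axis i 1) - P 0 1 (x + t *\<^sub>R axis i 1))
        has_field_derivative P 2 0 x - P 1 1 x) (at 0)"
      using DERIV_diff[OF P_i[OF x, of 1 0] P_i[OF x, of 0 1]] by (simp add: numeral_2_eq_2)
  qed
  moreover have "((\<lambda>t. partial_diff i j f (x + t *\<^sub>R axis j 1)) has_field_derivative
      P 1 1 x - P 0 2 x) (at 0)"
  proof (subst DERIV_cong_ev[OF refl _ refl])
    show "eventually (\<lambda>t. partial_diff i j f (x + t *\<^sub>R axis j 1)
        = P 1 0 (x + t *\<^sub>R axis j 1) - P 0 1 (x + t *\<^sub>R axis j 1)) (nhds 0)"
      using eventually_pos_orthant_line[OF x] by eventually_elim (rule first)
    show "((\<lambda>t. P 1 0 (x + t *\<^sub>R axis j 1) - P 0 1 (x + t *\<^sub>R axis j 1))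
        has_field_derivative P 1 1 x - P 0 2 x) (at 0)"
      using DERIV_diff[OF P_j[OF x, of 1 0] P_j[OF x, of 0 1]] by (simp add: numeral_2_eq_2)
  qed
  ultimately have "partial_diff i j (partial_diff i j f) x
      = (P 2 0 x - P 1 1 x) - (P 1 1 x - P 0 2 x)"
    by (simp add: partial_diff_def[of i j "partial_diff i j f"] partial_deriv_def DERIV_imp_deriv)
  then show "partial_diff i j (partial_diff i j f) x =
      (h i 2 (x $ i) * h j 0 (x $ j) - 2 * h i 1 (x $ i) * h j 1 (x $ j)
        + h i 0 (x $ i) * h j 2 (x $ j)) * R"
    by (simp add: P_x algebra_simps)
  show "partial_diff i j f x =
      (h i 1 (x $ i) * h j 0 (x $ j) - h i 0 (x $ i) * h j 1 (x $ j)) * R"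
    using first[OF x] by (simp add: P_x algebra_simps)
qed

section \<open>The entire function underlying the Bessel function\<close>

text \<open>
  For \<open>z > 0\<close>, \<open>bessel_J (2 k - 1) (sqrt z)\<close> is \<open>z powr (k - 1/2)\<close> times the power series with
  these coefficients.
\<close>

definition bessel_coeff :: "real \<Rightarrow> nat \<Rightarrow> real" where
  "bessel_coeff k m = 2 powr (1 - 2 * k) * (- 1 / 4) ^ m / (fact m * Gamma (2 * k + real m))"

text \<open>The index \<open>n\<close> is the order of the derivative, built in by termwise
  differentiation of the coefficients.\<close>

definition bessel_entire :: "real \<Rightarrow> nat \<Rightarrow> real \<Rightarrow> real" where
  "bessel_entire k n z = (\<Sum>m. (diffs ^^ n) (bessel_coeff k) m * z ^ m)"

text \<open>From \<open>Gamma (p + 1) = p * Gamma p\<close> with \<open>p = 2 * k + m\<close>. This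
  recurrence is the differential equation read coefficientwise, and it also controls
  convergence.\<close>

lemma bessel_coeff_Suc:
  assumes "k > 0"
  shows "real (Suc m) * (2 * k + real m) * bessel_coeff k (Suc m) = - bessel_coeff k m / 4"
proof -
  define p where "p = 2 * k + real m"
  have p: "p > 0" using assms by (simp add: p_def)
  then have "Gamma (p + 1) = p * Gamma p"
    by (intro Gamma_plus1) (auto simp: nonpos_Ints_def)
  moreover have "2 * k + real (Suc m) = p + 1"
    by (simp add: p_def)
  ultimately have "bessel_coeff k (Suc m)
      = 2 powr (1 - 2 * k) * (- 1 / 4) ^ Suc m / (real (Suc m) * fact m * (p * Gamma p))"
    unfolding bessel_coeff_def by (simp only: fact_Suc of_nat_mult)
  moreover have "bessel_coeff k m = 2 powr (1 - 2 * k) * (- 1 / 4) ^ m / (fact m * Gamma p)"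
    by (simp add: bessel_coeff_def p_def)
  ultimately show ?thesis
    using p Gamma_real_pos[OF p] unfolding p_def[symmetric]
    by (simp del: of_nat_Suc)
qed

lemma summable_bessel_coeff:
  assumes "k > 0"
  shows "summable (\<lambda>m. bessel_coeff k m * z ^ m)"
proof (rule summable_ratio_test[of "1 / 2" "nat \<lceil>\<bar>z\<bar>\<rceil> + 1"])
  \<comment> \<open>Beyond this threshold \<open>m \<ge> 1\<close> and
    \<open>m \<ge> \<bar>z\<bar>\<close>, hence \<open>q \<ge> m \<ge> \<bar>z\<bar>\<close>, and
    the ratio of successive terms \<open>\<bar>z\<bar> / (4 * q)\<close> is at most 1/4.\<close>
  fix m assume m: "nat \<lceil>\<bar>z\<bar>\<rceil> + 1 \<le> m"
  then have zm: "\<bar>z\<bar> \<le> real m" and "real m \<ge> 1" by linarith+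
  define q where "q = real (Suc m) * (2 * k + real m)"
  have "real m * 1 \<le> real (Suc m) * (2 * k + real m)"
    using assms \<open>real m \<ge> 1\<close> by (intro mult_mono) auto
  then have q: "q > 0" "\<bar>z\<bar> \<le> q"
    using zm \<open>real m \<ge> 1\<close> by (auto simp: q_def)
  have "bessel_coeff k (Suc m) = - bessel_coeff k m / (4 * q)"
    using bessel_coeff_Suc[OF assms, of m] q(1) unfolding q_def[symmetric] by (simp add: field_simps)
  then have "norm (bessel_coeff k (Suc m) * z ^ Suc m)
      = (\<bar>z\<bar> / q) / 4 * norm (bessel_coeff k m * z ^ m)"
    using q(1) by (simp add: abs_mult mult_ac)
  also have "\<dots> \<le> 1 / 2 * norm (bessel_coeff k m * z ^ m)"
    using q by (intro mult_right_mono) auto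
  finally show "norm (bessel_coeff k (Suc m) * z ^ Suc m) \<le> 1 / 2 * norm (bessel_coeff k m * z ^ m)" .
qed simp

lemma summable_bessel_entire:
  assumes "k > 0"
  shows "summable (\<lambda>m. (diffs ^^ n) (bessel_coeff k) m * z ^ m)"
proof (induction n arbitrary: z)
  case (Suc n)
  then show ?case by (simp add: termdiff_converges_all)
qed (simp add: summable_bessel_coeff[OF assms])

lemma DERIV_bessel_entire:
  assumes "k > 0"
  shows "(bessel_entire k n has_field_derivative bessel_entire k (Suc n) z) (at z)"
  unfolding bessel_entire_def
  using termdiffs_strong_converges_everywhere[OF summable_bessel_entire[OF assms]] by simp

lemma bessel_entire_ode:
  assumes "k > 0"
  shows "z * bessel_entire k 2 z + 2 * k * bessel_entire k 1 z + bessel_entire k 0 z / 4 = 0"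
proof -
  have sums: "(\<lambda>m. (diffs ^^ n) (bessel_coeff k) m * z ^ m) sums bessel_entire k n z" for n
    unfolding bessel_entire_def by (rule summable_sums[OF summable_bessel_entire[OF assms]])
  have "(\<lambda>m. real (Suc m) * diffs (bessel_coeff k) (Suc m) * z ^ Suc m) sums (z * bessel_entire k 2 z)"
    using sums_mult[OF sums[of 2], of z] by (simp add: numeral_2_eq_2 diffs_def mult_ac)
  \<comment> \<open>The added term at \<open>m = 0\<close> vanishes; after this shift all three
    series are aligned in \<open>z ^ m\<close>.\<close>
  then have "(\<lambda>m. real m * diffs (bessel_coeff k) m * z ^ m) sums (z * bessel_entire k 2 z)"
    using sums_Suc_imp[of "\<lambda>m. real m * diffs (bessel_coeff k) m * z ^ m"] by simp
  from sums_add[OF sums_add[OF this sums_mult[OF sums[of 1], of "2 * k"]]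
      sums_divide[OF sums[of 0], of 4]]
  have "(\<lambda>m. (real (Suc m) * (2 * k + real m) * bessel_coeff k (Suc m) + bessel_coeff k m / 4) * z ^ m)
      sums (z * bessel_entire k 2 z + 2 * k * bessel_entire k 1 z + bessel_entire k 0 z / 4)"
    by (simp add: diffs_def algebra_simps)
  then show ?thesis
    by (simp only: bessel_coeff_Suc[OF assms]) (simp add: sums_iff)
qed

text \<open>The prefactor \<open>(x * y) powr (- k + 1 / 2)\<close> cancels the leading power of the
  Bessel series, leaving only integer powers of \<open>x * y\<close>. The factor
  \<open>1 / 4 ^ m\<close> in the coefficients comes from halving the Bessel argument.\<close>

lemma J_kernel_eq:
  assumes k: "k > 0" and "x > 0" "y > 0"
  shows "J_kernel x y k = exp ((x + y) / 2) * bessel_entire k 0 (x * y)"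
proof -
  define z where "z = x * y"
  have z: "z > 0" using assms by (simp add: z_def)
  have term_eq: "(-1) ^ m / (fact m * Gamma (2 * k - 1 + real m + 1))
      * (sqrt z / 2) powr (2 * k - 1 + 2 * real m)
      = z powr (k - 1 / 2) * (bessel_coeff k m * z ^ m)" for m
  proof -
    have "(sqrt z / 2) powr (2 * k - 1 + 2 * real m)
        = z powr (k - 1 / 2 + real m) * 2 powr (1 - 2 * k - 2 * real m)"
    proof -
      have "2 powr (1 - 2 * k - 2 * real m) = 1 / 2 powr (2 * k - 1 + 2 * real m)"
        by (subst powr_minus_divide[symmetric]) (simp add: algebra_simps)
      moreover have "sqrt z powr (2 * k - 1 + 2 * real m) = z powr (k - 1 / 2 + real m)"
      proof -
        have "1 / 2 * (2 * k - 1 + 2 * real m) = k - 1 / 2 + real m"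
          by (simp add: algebra_simps)
        moreover have "sqrt z = z powr (1 / 2)"
          using powr_half_sqrt[of z] z by simp
        ultimately show ?thesis
          using powr_powr[of z "1 / 2" "2 * k - 1 + 2 * real m"] by metis
      qed
      moreover have "(sqrt z / 2) powr (2 * k - 1 + 2 * real m)
          = sqrt z powr (2 * k - 1 + 2 * real m) / 2 powr (2 * k - 1 + 2 * real m)"
        using z by (simp add: powr_divide)
      ultimately show ?thesis by (simp only: times_divide_eq_right mult_1_right)
    qed
    also have "2 powr (1 - 2 * k - 2 * real m) = 2 powr (1 - 2 * k) * (1 / 4) ^ m"
    proof -
      have "2 powr (2 * real m) = (4::real) ^ m"
        using powr_powr[of "2::real" 2 "real m"] by (simp add: powr_realpow)
      then show ?thesis
        by (simp only: powr_diff[of 2 "1 - 2 * k"] power_one_over times_divide_eq_right mult_1_right)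
    qed
    also have "z powr (k - 1 / 2 + real m) = z powr (k - 1 / 2) * z ^ m"
      using z by (simp add: powr_add powr_realpow)
    finally have power: "(sqrt z / 2) powr (2 * k - 1 + 2 * real m)
        = z powr (k - 1 / 2) * z ^ m * (2 powr (1 - 2 * k) * (1 / 4) ^ m)" .
    have sign: "(-1 / 4) ^ m = (-1) ^ m * (1 / 4 :: real) ^ m"
      by (simp add: power_mult_distrib[symmetric])
    have arg: "2 * k - 1 + real m + 1 = 2 * k + real m"
      by simp
    \<comment> \<open>The letters stand for the sign \<open>(-1) ^ m\<close>, the denominator,
      \<open>z powr (k - 1 / 2)\<close>, \<open>z ^ m\<close>, \<open>2 powr (1 - 2 * k)\<close> and
      \<open>(1 / 4) ^ m\<close>.\<close>
    have "s / d * (b * v * (c * q)) = b * (c * (s * q) / d * v)" for s d b v c q :: real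
      by simp
    then show ?thesis
      unfolding bessel_coeff_def power sign arg .
  qed
  have "bessel_J (2 * k - 1) (sqrt z) = z powr (k - 1 / 2) * bessel_entire k 0 z"
    unfolding bessel_J_def term_eq bessel_entire_def
    by (simp only: funpow_0 suminf_mult[OF summable_bessel_coeff[OF k]])
  moreover have "z powr (- k + 1 / 2) * z powr (k - 1 / 2) = 1"
    using z by (simp add: powr_add[symmetric])
  ultimately have "z powr (- k + 1 / 2) * bessel_J (2 * k - 1) (sqrt z) = bessel_entire k 0 z"
    by (simp only: mult.assoc[symmetric] mult_1_left)
  then show ?thesis
    by (simp add: J_kernel_def z_def mult.assoc)
qed

section \<open>Self-duality\<close>

text \<open>
  \<open>exp ((t + y) / 2) * twisted_deriv k y n 0 t\<close> is the \<open>n\<close>-th derivative of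
  \<open>J_kernel t y k\<close> in \<open>t\<close>: differentiating past the exponential replaces the operator \<open>d/dt\<close>
  by \<open>1/2 + d/dt\<close>. The index \<open>i\<close> counts additional derivatives of the factor itself.
\<close>

fun twisted_deriv :: "real \<Rightarrow> real \<Rightarrow> nat \<Rightarrow> nat \<Rightarrow> real \<Rightarrow> real" where
  "twisted_deriv k y 0 i t = y ^ i * bessel_entire k i (t * y)"
| "twisted_deriv k y (Suc n) i t = twisted_deriv k y n i t / 2 + twisted_deriv k y n (Suc i) t"

lemma DERIV_twisted_deriv:
  assumes "k > 0"
  shows "(twisted_deriv k y n i has_field_derivative twisted_deriv k y n (Suc i) t) (at t)"
proof (induction n arbitrary: i)
  case 0
  have "((\<lambda>t. bessel_entire k i (t * y)) has_field_derivative bessel_entire k (Suc i) (t * y) * y) (at t)"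
    by (rule DERIV_chain2[OF DERIV_bessel_entire[OF assms]]) (auto intro!: derivative_eq_intros)
  from DERIV_cmult[OF this, of "y ^ i"] show ?case
    by (simp add: mult_ac)
next
  case (Suc n)
  from DERIV_add[OF DERIV_cdivide[OF Suc[of i], of 2] Suc[of "Suc i"]] show ?case
    by simp
qed

definition kernel_deriv :: "real \<Rightarrow> real \<Rightarrow> nat \<Rightarrow> real \<Rightarrow> real" where
  "kernel_deriv k y n t = exp ((t + y) / 2) * twisted_deriv k y n 0 t"

text \<open>In the product rule the exponential contributes the half and the other factor raises its
  inner index, which is exactly the recursion of \<open>twisted_deriv\<close>.\<close>

lemma DERIV_kernel_deriv:
  assumes "k > 0"
  shows "(kernel_deriv k y n has_field_derivative kernel_deriv k y (Suc n) t) (at t)"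
  unfolding kernel_deriv_def
  by (rule derivative_eq_intros DERIV_twisted_deriv[OF assms] refl | simp add: algebra_simps)+

lemma J_kernel_eq_kernel_deriv:
  "k > 0 \<Longrightarrow> x > 0 \<Longrightarrow> y > 0 \<Longrightarrow> J_kernel x y k = kernel_deriv k y 0 x"
  by (simp add: J_kernel_eq kernel_deriv_def)

lemma J_kernel_commute: "J_kernel x y k = J_kernel y x k"
  by (simp add: J_kernel_def mult.commute add.commute)

text \<open>\<open>T\<close> is the generator's term for one pair, with the common factor of the
  other coordinates removed.\<close>

lemma L_BEP_pair_symmetric:
  fixes k1 k2 :: real
  assumes k: "k1 > 0" "k2 > 0"
  defines "T \<equiv> \<lambda>x1 x2 y1 y2.
      x1 * x2 * (kernel_deriv k1 y1 2 x1 * kernel_deriv k2 y2 0 x2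
        - 2 * kernel_deriv k1 y1 1 x1 * kernel_deriv k2 y2 1 x2
        + kernel_deriv k1 y1 0 x1 * kernel_deriv k2 y2 2 x2)
      - 2 * (k2 * x1 - k1 * x2) *
        (kernel_deriv k1 y1 1 x1 * kernel_deriv k2 y2 0 x2
          - kernel_deriv k1 y1 0 x1 * kernel_deriv k2 y2 1 x2)"
  shows "T x1 x2 y1 y2 = T y1 y2 x1 x2"
proof -
  \<comment> \<open>What remains of \<open>T\<close> once the second derivatives are eliminated. Its
    symmetry is visible: apart from \<open>x2 * y1 + x1 * y2\<close>, which the exchange preserves,
    the bracket depends only on the products \<open>x1 * y1\<close> and
    \<open>x2 * y2\<close>.\<close>
  define S where "S x1 x2 y1 y2 = exp ((x1 + y1) / 2) * exp ((x2 + y2) / 2) *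
      (- 2 * k2 * x1 * y1 * bessel_entire k1 1 (x1 * y1) * bessel_entire k2 0 (x2 * y2)
       - 2 * k1 * x2 * y2 * bessel_entire k1 0 (x1 * y1) * bessel_entire k2 1 (x2 * y2)
       - (x2 * y1 + x1 * y2) / 4 * bessel_entire k1 0 (x1 * y1) * bessel_entire k2 0 (x2 * y2)
       - 2 * x1 * x2 * y1 * y2 * bessel_entire k1 1 (x1 * y1) * bessel_entire k2 1 (x2 * y2))"
    for x1 x2 y1 y2
  have T_S: "T x1 x2 y1 y2 = S x1 x2 y1 y2" for x1 x2 y1 y2
  proof -
    define e1 where "e1 = exp ((x1 + y1) / 2)"
    define e2 where "e2 = exp ((x2 + y2) / 2)"
    define g0 g1 g2 where "g0 = bessel_entire k1 0 (x1 * y1)"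
      and "g1 = bessel_entire k1 1 (x1 * y1)" and "g2 = bessel_entire k1 2 (x1 * y1)"
    define h0 h1 h2 where "h0 = bessel_entire k2 0 (x2 * y2)"
      and "h1 = bessel_entire k2 1 (x2 * y2)" and "h2 = bessel_entire k2 2 (x2 * y2)"
    have G: "x1 * y1 * g2 + 2 * k1 * g1 + g0 / 4 = 0"
      using bessel_entire_ode[OF k(1)] by (simp add: g0_def g1_def g2_def)
    have H: "x2 * y2 * h2 + 2 * k2 * h1 + h0 / 4 = 0"
      using bessel_entire_ode[OF k(2)] by (simp add: h0_def h1_def h2_def)
    have K1: "kernel_deriv k1 y1 0 x1 = e1 * g0"
      "kernel_deriv k1 y1 1 x1 = e1 * (g0 / 2 + y1 * g1)"
      "kernel_deriv k1 y1 2 x1 = e1 * (g0 / 4 + y1 * g1 + y1\<^sup>2 * g2)"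
      by (simp_all add: kernel_deriv_def e1_def g0_def g1_def g2_def numeral_2_eq_2 field_simps)
    have K2: "kernel_deriv k2 y2 0 x2 = e2 * h0"
      "kernel_deriv k2 y2 1 x2 = e2 * (h0 / 2 + y2 * h1)"
      "kernel_deriv k2 y2 2 x2 = e2 * (h0 / 4 + y2 * h1 + y2\<^sup>2 * h2)"
      by (simp_all add: kernel_deriv_def e2_def h0_def h1_def h2_def numeral_2_eq_2 field_simps)
    \<comment> \<open>The multipliers are read off from the second derivatives: in \<open>T\<close>,
      up to the exponentials, they occur as \<open>x1 * x2 * y1\<^sup>2 * g2 * h0\<close> and
      \<open>x1 * x2 * y2\<^sup>2 * g0 * h2\<close>.\<close>
    have "T x1 x2 y1 y2 - S x1 x2 y1 y2 = e1 * e2 *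
        (x2 * y1 * h0 * (x1 * y1 * g2 + 2 * k1 * g1 + g0 / 4)
         + x1 * y2 * g0 * (x2 * y2 * h2 + 2 * k2 * h1 + h0 / 4))"
      unfolding T_def S_def K1 K2 e1_def[symmetric] e2_def[symmetric]
        g0_def[symmetric] g1_def[symmetric] h0_def[symmetric] h1_def[symmetric]
      by (simp add: field_simps power2_eq_square)
    then show ?thesis by (simp add: G H)
  qed
  have "S x1 x2 y1 y2 = S y1 y2 x1 x2"
    by (simp add: S_def algebra_simps)
  then show ?thesis by (simp add: T_S)
qed

theorem theorem4p18:
  fixes k :: "real ^ 'n::{finite,linorder}"
  assumes "\<And>j. k $ j > 0"
  shows "self_dual (L_BEP k) (\<lambda>x y. \<Prod>j\<in>UNIV. J_kernel (x $ j) (y $ j) (k $ j))"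
proof -
  define D where "D = (\<lambda>x y. \<Prod>j\<in>UNIV. J_kernel (x $ j) (y $ j) (k $ j))"
  define h where "h = (\<lambda>y l. kernel_deriv (k $ l) (y $ l))"
  \<comment> \<open>Symmetry lets the action on the second argument, and smoothness in it, be
    treated as the first-argument case with the points exchanged.\<close>
  have D_commute: "D x y = D y x" for x y
    by (simp add: D_def J_kernel_commute)
  have D_h: "D x y = (\<Prod>l\<in>UNIV. h y l 0 (x $ l))"
    if "x \<in> pos_orthant" "y \<in> pos_orthant" for x y
    using that by (simp add: D_def h_def J_kernel_eq_kernel_deriv pos_orthant_def assms)
  have DERIV_h: "(h y l n has_field_derivative h y l (Suc n) t) (at t)" for y l n t
    unfolding h_def by (rule DERIV_kernel_deriv[OF assms])
  have smooth: "smooth_on pos_orthant (\<lambda>x. D x y)" if "y \<in> pos_orthant" for y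
    using smooth_on_prod[where h = "h y" and f = "\<lambda>x. D x y"] D_h that DERIV_h by blast
  have "L_BEP k (\<lambda>x'. D x' y) x = L_BEP k (\<lambda>y'. D y' x) y"
    if x: "x \<in> pos_orthant" and y: "y \<in> pos_orthant" for x y
    unfolding L_BEP_def
  proof (intro sum.cong refl, clarify)
    fix i j :: 'n assume "i < j"
    then have "i \<noteq> j" by simp
    \<comment> \<open>The coordinates outside the pair carry undifferentiated kernels, which are
      symmetric, so both sides share this factor and only the pair expressions need
      comparison.\<close>
    have R: "(\<Prod>l\<in>UNIV - {i, j}. kernel_deriv (k $ l) (y $ l) 0 (x $ l))
        = (\<Prod>l\<in>UNIV - {i, j}. kernel_deriv (k $ l) (x $ l) 0 (y $ l))"
      by (simp add: kernel_deriv_def mult.commute add.commute)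
    note diff_x = partial_diff_prod[where h = "h y" and f = "\<lambda>x'. D x' y",
        OF D_h[OF _ y] DERIV_h x \<open>i \<noteq> j\<close>]
    note diff_y = partial_diff_prod[where h = "h x" and f = "\<lambda>y'. D y' x",
        OF D_h[OF _ x] DERIV_h y \<open>i \<noteq> j\<close>]
    have factor: "a * (A * R) - c * (B * R) = (a * A - c * B) * R" for a A c B R :: real
      by (simp add: algebra_simps)
    note pair = L_BEP_pair_symmetric[OF assms[of i] assms[of j], of "x $ i" "x $ j" "y $ i" "y $ j"]
    show "x $ i * x $ j * partial_diff i j (partial_diff i j (\<lambda>x'. D x' y)) x
        - 2 * (k $ j * x $ i - k $ i * x $ j) * partial_diff i j (\<lambda>x'. D x' y) x
      = y $ i * y $ j * partial_diff i j (partial_diff i j (\<lambda>y'. D y' x)) y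
        - 2 * (k $ j * y $ i - k $ i * y $ j) * partial_diff i j (\<lambda>y'. D y' x) y"
      by (simp only: diff_x diff_y factor h_def pair R)
  qed
  then have "self_dual (L_BEP k) D"
    using smooth by (simp add: self_dual_def D_commute)
  then show ?thesis by (simp add: D_def)
qed

end
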